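(* Let $K$ be a field of characteristic zero and $r\ge 2$. Consider a nonzero polynomial $P(\underline{x},y)=\sum_{|\underline{i}|=0}^{d_x}\sum_{j=0}^{d_y}a_{\underline{i},j}\underline{x}^{\underline{i}}y^j\in K[\underline{x},y]$ of total degree in $\underline{x}$ bounded by $d_x$ and degree in $y$ bounded by $d_y$, and a formal power series $y_0=\sum_{\underline{n}>_{\mathrm{grlex}} \underline{0}}c_{\underline{n}}\underline{x}^{\underline{n}}\in K[[\underline{x}]]$, $c_{(0,\ldots,0,1)}\neq 0$, which is a simple root of $P$ (i.e. $P(\underline{x},y_0)=0$ and $\frac{\partial P}{\partial y}(\underline{x},y_0)\ne 0$). Let $z_{\underline{k}}$, $P_{\underline{k}}$, $\underline{i}_{\underline{k}}$, $\underline{k}_0$ and $\omega_0\neq 0$ be as defined in the context. Then, for any $\underline{k}>_{\mathrm{grlex}}\underline{k}_0$: \begin{itemize} \item either the polynomial $z_{S(\underline{k})}=\sum_{\underline{n}=(0,\ldots,0,1)}^{S(\underline{k})}c_{\underline{n}}\underline{x}^{\underline{n}}$ is a solution of $P(\underline{x},y)=0$; \item or the multivariate Laurent polynomial $${}_{\underline{k}}R(\underline{x},y):=\frac{P_{\underline{k}}(\underline{x},y+c_{S(\underline{k})})}{-\omega_0\underline{x}^{\underline{i}_{\underline{k}}}}=-y+{}_{\underline{k}}Q(\underline{x},y)$$ defines a strongly reduced Henselian equation $y={}_{\underline{k}}Q(\underline{x},y)$, which is satisfied by $$t_{S(\underline{k})}:=\frac{y_0-z_{S(\underline{k})}}{\underline{x}^{S(\underline{k})}}=c_{S^2(\underline{k})}\underline{x}^{S^2(\underline{k})-S(\underline{k})}+c_{S^3(\underline{k})}\underline{x}^{S^3(\underline{k})-S(\underline{k})}+\cdots.$$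 \end{itemize}
   Context: For $\underline{n}\in\mathbb{Z}^r$ put $|\underline{n}|=n_1+\cdots+n_r$. Graded lexicographic order on $\mathbb{Z}^r$: $\underline{n}\leq_{\mathrm{grlex}}\underline{m}$ iff $|\underline{n}|<|\underline{m}|$, or $|\underline{n}|=|\underline{m}|$ and $\underline{n}\leq_{\mathrm{lex}}\underline{m}$ (comparing first coordinates first). $w$ denotes the valuation sending a nonzero (Laurent) polynomial, or a generalized series in $K((x_1^{\mathbb{Z}},\ldots,x_r^{\mathbb{Z}}))^{\mathrm{grlex}}$ (series with exponents in $\mathbb{Z}^r$ and $\leq_{\mathrm{grlex}}$-well-ordered support), to the $\leq_{\mathrm{grlex}}$-minimum of its support, $w(0)=\infty$; for $Q=\sum_j a_j(\underline{x})y^j$, $w(Q):=\min_j w(a_j)$. A strongly reduced Henselian equation is an equation $y=Q(\underline{x},y)$ with $Q\in K[x_1,x_1^{-1},\ldots,x_r,x_r^{-1}][y]$, $w(Q)>_{\mathrm{grlex}}\underline{0}$ and $Q(\underline{x},0)\not\equiv 0$. For $\underline{k}\in\mathbb{N}^r$: $S(\underline{k})$ is the successor of $\underline{k}$ in $(\mathbb{N}^r,\leq_{\mathrm{grlex}})$, and $S^2(\underline{k})=S(S(\underline{k}))$, etc.; $z_{\underline{0}}:=0$ and $z_{\underline{k}}:=\sum_{(0,\ldots,0,1)\leq_{\mathrm{grlex}}\underline{n}\leq_{\mathrm{grlex}}\underline{k}}c_{\underline{n}}\underline{x}^{\underline{n}}$ for $\underline{k}\neq\underline{0}$ (a sum $\sum_{\underline{n}=\underline{a}}^{\underline{b}}$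 means over all $\underline{n}\in\mathbb{N}^r$ with $\underline{a}\leq_{\mathrm{grlex}}\underline{n}\leq_{\mathrm{grlex}}\underline{b}$); $$P_{\underline{k}}(\underline{x},y):=P(\underline{x},z_{\underline{k}}+\underline{x}^{S(\underline{k})}y)=\sum_{\underline{i}\geq_{\mathrm{grlex}}\underline{i}_{\underline{k}}}\pi^P_{\underline{k},\underline{i}}(y)\,\underline{x}^{\underline{i}},\qquad \underline{i}_{\underline{k}}:=w(P_{\underline{k}}),\quad \pi^P_{\underline{k},\underline{i}}(y)\in K[y].$$ Since $y_0$ is a simple root of $P$, there exists a $\leq_{\mathrm{grlex}}$-lowest multi-index $\underline{k}_0\in\mathbb{N}^r$ such that $\underline{i}_{S(\underline{k}_0)}=\underline{i}_{\underline{k}_0}-S(\underline{k}_0)+S^2(\underline{k}_0)$; this is $\underline{k}_0$. One sets $\omega_0:=(\pi^P_{\underline{k}_0,\underline{i}_{\underline{k}_0}})'(c_{S(\underline{k}_0)})$, which is nonzero (it is the coefficient of the $\leq_{\mathrm{grlex}}$-lowest monomial of $\frac{\partial P}{\partial y}(\underline{x},y_0)$). *)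

theory Defs
  imports
    "HOL-Computational_Algebra.Polynomial"
    "HOL-Library.Poly_Mapping"
    "HOL-Library.Extended"
    "HOL-Library.FuncSet"
    "HOL-Library.Cardinality"
begin

section \<open>Exponents in \<open>\<int>\<^sup>r\<close> with the graded lexicographic order\<close>

text \<open>
  The index type \<open>'r\<close> plays the role of \<open>{1, \<dots>, r}\<close>; its linear order
  says which coordinate is the first one.  The copy \<open>'r mexp\<close> of \<open>'r \<Rightarrow> int\<close> is needed because
  functions already carry the pointwise order.
\<close>

typedef 'r mexp = "UNIV :: ('r \<Rightarrow> int) set"
  morphisms mexp_nth Mexp ..

lemma mexp_nth_Mexp [simp]: "mexp_nth (Mexp f) = f"
  by (simp add: Mexp_inverse)

lemma mexp_eqI: "(\<And>i. mexp_nth n i = mexp_nth m i) \<Longrightarrow> n = m"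
  by (metis ext mexp_nth_inject)

instantiation mexp :: (type) ab_group_add
begin

definition "0 = Mexp (\<lambda>_. 0)"
definition "n + m = Mexp (\<lambda>i. mexp_nth n i + mexp_nth m i)"
definition "n - m = Mexp (\<lambda>i. mexp_nth n i - mexp_nth m i)"
definition "- n = Mexp (\<lambda>i. - mexp_nth n i)"

instance
  by standard
    (auto intro!: mexp_eqI
      simp: zero_mexp_def plus_mexp_def minus_mexp_def uminus_mexp_def)

end

lemma mexp_nth_arith [simp]:
  "mexp_nth 0 i = 0"
  "mexp_nth (n + m) i = mexp_nth n i + mexp_nth m i"
  "mexp_nth (n - m) i = mexp_nth n i - mexp_nth m i"
  "mexp_nth (- n) i = - mexp_nth n i"
  by (simp_all add: zero_mexp_def plus_mexp_def minus_mexp_def uminus_mexp_def)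

definition total_deg :: "'r::finite mexp \<Rightarrow> int" where
  "total_deg n = (\<Sum>i\<in>UNIV. mexp_nth n i)"

definition lex_less :: "'r::linorder mexp \<Rightarrow> 'r mexp \<Rightarrow> bool" where
  "lex_less n m \<longleftrightarrow> (\<exists>i. mexp_nth n i < mexp_nth m i \<and> (\<forall>j<i. mexp_nth n j = mexp_nth m j))"

lemma total_add: "total_deg (n + m) = total_deg n + total_deg m"
  by (simp add: total_deg_def sum.distrib)

lemma lex_less_irrefl: "\<not> lex_less n n"
  by (simp add: lex_less_def)

lemma lex_less_trans: "lex_less a b \<Longrightarrow> lex_less b c \<Longrightarrow> lex_less a c"
proof -
  assume "lex_less a b" "lex_less b c"
  then obtain i j where i: "mexp_nth a i < mexp_nth b i" "\<forall>l<i. mexp_nth a l = mexp_nth b l"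
    and j: "mexp_nth b j < mexp_nth c j" "\<forall>l<j. mexp_nth b l = mexp_nth c l"
    by (auto simp: lex_less_def)
  show "lex_less a c"
    unfolding lex_less_def
    by (rule exI[of _ "min i j"], cases i j rule: linorder_cases)
      (use i j in \<open>auto simp: min_def\<close>)
qed

lemma lex_less_total:
  fixes n m :: "'r::{finite,linorder} mexp"
  assumes "n \<noteq> m" shows "lex_less n m \<or> lex_less m n"
proof -
  define D where "D = {i. mexp_nth n i \<noteq> mexp_nth m i}"
  have "D \<noteq> {}" using assms mexp_eqI[of n m] by (auto simp: D_def)
  then have D: "Min D \<in> D" "\<forall>j<Min D. j \<notin> D"
    by (auto simp: Min_in)
  then show ?thesis
    unfolding lex_less_def D_def by (metis (mono_tags, lifting) linorder_neqE mem_Collect_eq)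
qed

lemma lex_less_add: "lex_less a b \<Longrightarrow> lex_less (c + a) (c + b)"
  by (auto simp: lex_less_def)

definition grlex_less :: "'r::{finite,linorder} mexp \<Rightarrow> 'r mexp \<Rightarrow> bool" where
  "grlex_less n m \<longleftrightarrow> total_deg n < total_deg m \<or> total_deg n = total_deg m \<and> lex_less n m"

instantiation mexp :: ("{finite,linorder}") linordered_ab_group_add
begin

definition less_mexp_def: "n < m \<longleftrightarrow> grlex_less n m"

definition less_eq_mexp_def: "n \<le> m \<longleftrightarrow> grlex_less n m \<or> n = m"

instance
proof
  fix a b c :: "'a mexp"
  show "(a < b) = (a \<le> b \<and> \<not> b \<le> a)"
    by (auto simp: less_mexp_def less_eq_mexp_def grlex_less_def lex_less_irrefl dest: lex_less_trans)
  show "a \<le> a" by (simp add: less_eq_mexp_def)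
  show "a \<le> b \<Longrightarrow> b \<le> c \<Longrightarrow> a \<le> c"
    by (auto simp: less_mexp_def less_eq_mexp_def grlex_less_def dest: lex_less_trans)
  show "a \<le> b \<Longrightarrow> b \<le> a \<Longrightarrow> a = b"
    by (auto simp: less_mexp_def less_eq_mexp_def grlex_less_def lex_less_irrefl dest: lex_less_trans)
  show "a \<le> b \<or> b \<le> a"
    using lex_less_total[of a b] by (auto simp: less_mexp_def less_eq_mexp_def grlex_less_def)
  show "a \<le> b \<Longrightarrow> c + a \<le> c + b"
    by (auto simp: less_mexp_def less_eq_mexp_def grlex_less_def total_add lex_less_add)
qed

end

definition nat_exps :: "'r mexp set" where
  "nat_exps = {n. \<forall>i. 0 \<le> mexp_nth n i}"

lemma finite_nat_exps_le:
  fixes k :: "'r::{finite,linorder} mexp"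
  shows "finite {n \<in> nat_exps. n \<le> k}"
proof -
  have "{n \<in> nat_exps. n \<le> k} \<subseteq> Mexp ` (UNIV \<rightarrow>\<^sub>E {0..total_deg k})"
  proof
    fix n assume n: "n \<in> {n \<in> nat_exps. n \<le> k}"
    then have "total_deg n \<le> total_deg k"
      by (auto simp: less_eq_mexp_def grlex_less_def less_mexp_def)
    moreover have "mexp_nth n i \<le> total_deg n" for i
      unfolding total_deg_def using n by (intro member_le_sum) (auto simp: nat_exps_def)
    ultimately have "mexp_nth n \<in> UNIV \<rightarrow>\<^sub>E {0..total_deg k}"
      using n by (fastforce simp: nat_exps_def intro: order_trans)
    then show "n \<in> Mexp ` (UNIV \<rightarrow>\<^sub>E {0..total_deg k})"
      by (metis image_eqI mexp_nth_inverse)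
  qed
  then show ?thesis
    by (rule finite_subset) (intro finite_imageI finite_PiE, auto)
qed

text \<open>In particular every element of \<open>K[[x]]\<close> has well-ordered support.\<close>

lemma wfp_on_nat_exps: "wfp_on (nat_exps :: 'r::{finite,linorder} mexp set) (<)"
  unfolding wfp_on_iff_ex_minimal
proof (intro allI impI)
  fix B :: "'r mexp set"
  assume B: "B \<subseteq> nat_exps" and "B \<noteq> {}"
  then obtain b where b: "b \<in> B" by blast
  let ?C = "{n \<in> B. n \<le> b}"
  have fin: "finite ?C"
    by (rule finite_subset[OF _ finite_nat_exps_le[of b]]) (use B in auto)
  have "Min ?C \<in> ?C"
    using fin b by (intro Min_in) auto
  moreover have "y \<notin> B" if "y < Min ?C" for y
    using that fin calculation by (auto dest: Min_le)
  ultimately show "\<exists>z\<in>B. \<forall>y. y < z \<longrightarrow> y \<notin> B" by blast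
qed

text \<open>Successor in \<open>\<nat>\<^sup>r\<close>, and \<open>(0, \<dots>, 0, 1)\<close>.\<close>

definition succ_exp :: "'r::{finite,linorder} mexp \<Rightarrow> 'r mexp" where
  "succ_exp k = (LEAST m. m \<in> nat_exps \<and> k < m)"

definition last_unit :: "'r::{finite,linorder} mexp" where
  "last_unit = Mexp (\<lambda>i. if i = Max UNIV then 1 else 0)"


section \<open>Generalized series with well-ordered support\<close>

text \<open>For \<open>'e = 'r mexp\<close> this is the ring \<open>K((x\<^sub>1\<^sup>\<int>, \<dots>, x\<^sub>r\<^sup>\<int>))\<^sup>g\<^sup>r\<^sup>l\<^sup>e\<^sup>x\<close>.\<close>

typedef (overloaded) ('e, 'a) gseries =
  "{f :: 'e::linorder \<Rightarrow> 'a::zero. wfp_on {n. f n \<noteq> 0} (<)}"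
  morphisms gcoeff Abs_gseries
  by (rule exI[of _ "\<lambda>_. 0"]) (simp add: wfp_on_def)

definition supp :: "('e::linorder, 'a::zero) gseries \<Rightarrow> 'e set" where
  "supp f = {n. gcoeff f n \<noteq> 0}"

lemma gseries_eqI: "(\<And>n. gcoeff f n = gcoeff g n) \<Longrightarrow> f = g"
  by (metis ext gcoeff_inject)

lemma wfp_on_supp: "wfp_on (supp f) (<)"
  using gcoeff[of f] by (simp add: supp_def)

lemma not_in_supp: "n \<notin> supp f \<longleftrightarrow> gcoeff f n = 0"
  by (simp add: supp_def)

lemma gcoeff_Abs_gseries:
  assumes "wfp_on A (<)" "\<And>n. n \<notin> A \<Longrightarrow> f n = 0"
  shows "gcoeff (Abs_gseries f) = f"
proof (rule Abs_gseries_inverse, clarify)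
  show "wfp_on {n. f n \<noteq> 0} (<)"
    by (rule wfp_on_subset[OF assms(1)]) (use assms(2) in blast)
qed

lemma wfp_on_no_chain:
  fixes A :: "'e::linorder set"
  shows "wfp_on A (<) \<longleftrightarrow> \<not> (\<exists>f. \<forall>i. f i \<in> A \<and> f (Suc i) < f i)"
proof -
  let ?r = "{(x, y). x < y \<and> x \<in> A \<and> y \<in> A}"
  have "wfp_on A (<) \<longleftrightarrow> wf ?r"
    by (rule wfp_on_iff_wfp[of A "(<)", unfolded wfp_def])
  also have "\<dots> \<longleftrightarrow> \<not> (\<exists>f. \<forall>i. (f (Suc i), f i) \<in> ?r)"
    by (rule wf_iff_no_infinite_down_chain)
  also have "(\<exists>f. \<forall>i. (f (Suc i), f i) \<in> ?r) \<longleftrightarrow> (\<exists>f. \<forall>i. f i \<in> A \<and> f (Suc i) < f i)"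
    by (rule ex_cong1) blast
  finally show ?thesis .
qed

lemma wfp_on_incseq_subseq:
  fixes A :: "'e::linorder set"
  assumes "wfp_on A (<)" "\<And>i. s i \<in> A"
  shows "\<exists>g :: nat \<Rightarrow> nat. strict_mono g \<and> (\<forall>i. s (g i) \<le> s (g (Suc i)))"
proof -
  let ?P = "\<lambda>i j. i < j \<and> s i \<le> s j \<and> (\<forall>l>i. s i \<le> s l)"
  have min: "\<exists>j\<ge>i. \<forall>l\<ge>i. s j \<le> s l" for i
  proof -
    have "s ` {i..} \<subseteq> A" "s ` {i..} \<noteq> {}" using assms(2) by auto
    then obtain z where "z \<in> s ` {i..}" "\<forall>y. y < z \<longrightarrow> y \<notin> s ` {i..}"
      using assms(1) unfolding wfp_on_iff_ex_minimal by meson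
    then show ?thesis
      by (metis (no_types, lifting) atLeast_iff image_iff not_le)
  qed
  then obtain h where h: "\<And>i. i \<le> h i" "\<And>i l. i \<le> l \<Longrightarrow> s (h i) \<le> s l" by metis
  define g where "g = rec_nat (h 0) (\<lambda>_ j. h (Suc j))"
  have g: "g 0 = h 0" "\<And>n. g (Suc n) = h (Suc (g n))" by (simp_all add: g_def)
  have "strict_mono g"
    unfolding strict_mono_Suc_iff using h(1) g(2) by (metis Suc_le_lessD)
  moreover have "s (g i) \<le> s (g (Suc i))" for i
  proof (cases i)
    case 0
    then show ?thesis using g h by simp
  next
    case (Suc j)
    have "Suc (g j) \<le> g (Suc i)"
      using \<open>strict_mono g\<close> Suc by (simp add: Suc_le_eq strict_mono_less)
    then show ?thesis using g(2)[of j] h(2) Suc by metis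
  qed
  ultimately show ?thesis by blast
qed

lemma wfp_on_Un:
  fixes A B :: "'e::linorder set"
  assumes "wfp_on A (<)" "wfp_on B (<)" shows "wfp_on (A \<union> B) (<)"
  unfolding wfp_on_iff_ex_minimal
proof (intro allI impI)
  fix C assume C: "C \<subseteq> A \<union> B" and "C \<noteq> {}"
  then obtain x where x: "x \<in> C" by blast
  show "\<exists>z\<in>C. \<forall>y. y < z \<longrightarrow> y \<notin> C"
  proof (cases "C \<inter> A = {} \<or> C \<inter> B = {}")
    case True
    then have "C \<subseteq> A \<or> C \<subseteq> B" using C by blast
    then show ?thesis
      using assms x unfolding wfp_on_iff_ex_minimal by blast
  next
    case False
    then obtain u v where u: "u \<in> C \<inter> A" "\<And>y. y < u \<Longrightarrow> y \<notin> C \<inter> A"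
      and v: "v \<in> C \<inter> B" "\<And>y. y < v \<Longrightarrow> y \<notin> C \<inter> B"
      using assms unfolding wfp_on_iff_ex_minimal by (meson inf_le2)
    then show ?thesis
      using C by (intro bexI[of _ "min u v"]) (auto simp: min_def)
  qed
qed

definition sumset :: "'e::plus set \<Rightarrow> 'e set \<Rightarrow> 'e set" where
  "sumset A B = {a + b | a b. a \<in> A \<and> b \<in> B}"

definition pairs :: "'e::plus set \<Rightarrow> 'e set \<Rightarrow> 'e \<Rightarrow> ('e \<times> 'e) set" where
  "pairs A B n = {(a, b). a \<in> A \<and> b \<in> B \<and> a + b = n}"

lemma wfp_on_sumset:
  fixes A B :: "'e::linordered_ab_group_add set"
  assumes "wfp_on A (<)" "wfp_on B (<)" shows "wfp_on (sumset A B) (<)"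
  unfolding wfp_on_no_chain
proof safe
  fix f assume f: "\<forall>i. f i \<in> sumset A B \<and> f (Suc i) < f i"
  have "\<exists>p. fst p \<in> A \<and> snd p \<in> B \<and> f i = fst p + snd p" for i
    using f[rule_format, of i] by (auto simp: sumset_def)
  then obtain p where p: "\<And>i. fst (p i) \<in> A \<and> snd (p i) \<in> B \<and> f i = fst (p i) + snd (p i)"
    by metis
  define a b where "a i = fst (p i)" and "b i = snd (p i)" for i
  then have ab: "a i \<in> A" "b i \<in> B" "f i = a i + b i" for i
    using p[of i] by simp_all
  obtain g :: "nat \<Rightarrow> nat" where g: "strict_mono g" "\<forall>i. a (g i) \<le> a (g (Suc i))"
    using wfp_on_incseq_subseq[of A a, OF assms(1) ab(1)] by (elim exE conjE)
  have decr: "f j < f i" if "i < j" for i j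
    using that
  proof (induction j)
    case (Suc j)
    moreover have "f (Suc j) < f j" using f by blast
    ultimately show ?case
      by (cases "i = j") (auto simp: less_Suc_eq intro: less_trans)
  qed simp
  have "f (g (Suc i)) < f (g i)" for i
    by (rule decr, rule strict_monoD[OF g(1)]) simp
  then have "a (g (Suc i)) + b (g (Suc i)) < a (g i) + b (g i)" for i
    by (simp add: ab(3))
  then have "b (g (Suc i)) < b (g i)" for i
    using add_mono[OF g(2)[rule_format, of i], of "b (g i)" "b (g (Suc i))"] by (meson not_le)
  then have "\<exists>h. \<forall>i. h i \<in> B \<and> h (Suc i) < h i"
    using ab(2) by (intro exI[of _ "\<lambda>i. b (g i)"]) simp
  then show False
    using assms(2) unfolding wfp_on_no_chain by blast
qed

lemma finite_pairs:
  fixes A B :: "'e::linordered_ab_group_add set"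
  assumes "wfp_on A (<)" "wfp_on B (<)" shows "finite (pairs A B n)"
proof (rule ccontr)
  assume "infinite (pairs A B n)"
  moreover have "inj_on fst (pairs A B n)"
    by (auto simp: inj_on_def pairs_def)
  ultimately have "infinite (fst ` pairs A B n)"
    using finite_imageD by blast
  then obtain s :: "nat \<Rightarrow> 'e" where s: "inj s" "range s \<subseteq> fst ` pairs A B n"
    using infinite_countable_subset by metis
  have sAB: "s i \<in> A \<and> n - s i \<in> B" for i
  proof -
    have "s i \<in> fst ` pairs A B n" using s(2) by blast
    then obtain b where "s i \<in> A" "b \<in> B" "s i + b = n"
      by (auto simp: pairs_def)
    then show ?thesis by auto
  qed
  then have sA: "s i \<in> A" and sB: "n - s i \<in> B" for i by simp_all
  obtain g :: "nat \<Rightarrow> nat" where g: "strict_mono g" "\<forall>i. s (g i) \<le> s (g (Suc i))"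
    using wfp_on_incseq_subseq[of A s, OF assms(1) sA] by (elim exE conjE)
  have "s (g i) \<noteq> s (g (Suc i))" for i
    using s(1) g(1) by (metis injD n_not_Suc_n strict_mono_eq)
  then have "n - s (g (Suc i)) < n - s (g i)" for i
    using g(2) by (metis diff_strict_left_mono order_le_imp_less_or_eq)
  then have "\<exists>h. \<forall>i. h i \<in> B \<and> h (Suc i) < h i"
    using sB by (intro exI[of _ "\<lambda>i. n - s (g i)"]) simp
  then show False
    using assms(2) unfolding wfp_on_no_chain by blast
qed

instantiation gseries :: (linorder, ab_group_add) ab_group_add
begin

definition "0 = Abs_gseries (\<lambda>_. 0)"
definition "f + g = Abs_gseries (\<lambda>n. gcoeff f n + gcoeff g n)"
definition "f - g = Abs_gseries (\<lambda>n. gcoeff f n - gcoeff g n)"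
definition "- f = Abs_gseries (\<lambda>n. - gcoeff f n)"

lemma gcoeff_group [simp]:
  "gcoeff 0 n = 0"
  "gcoeff (f + g) n = gcoeff f n + gcoeff g n"
  "gcoeff (f - g) n = gcoeff f n - gcoeff g n"
  "gcoeff (- f) n = - gcoeff f n"
  for f g :: "('a, 'b) gseries"
  unfolding zero_gseries_def plus_gseries_def minus_gseries_def uminus_gseries_def
  by (subst gcoeff_Abs_gseries[of "supp f \<union> supp g"];
      auto simp: not_in_supp intro!: wfp_on_Un wfp_on_supp)+

instance
  by standard (auto intro!: gseries_eqI simp: algebra_simps)

end

instantiation gseries :: (linordered_ab_group_add, comm_ring_1) comm_ring_1
begin

definition "1 = Abs_gseries (\<lambda>n. if n = 0 then 1 else 0)"
definition "f * g = Abs_gseries (\<lambda>n. \<Sum>(a, b) \<in> pairs (supp f) (supp g) n. gcoeff f a * gcoeff g b)"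

lemma gcoeff_one: "gcoeff (1 :: ('a, 'b) gseries) n = (if n = 0 then 1 else 0)"
  unfolding one_gseries_def
  by (subst gcoeff_Abs_gseries[of "{0}"]) (auto simp: wfp_on_def)

lemma gcoeff_mult_supp:
  fixes f g :: "('a, 'b) gseries"
  shows "gcoeff (f * g) n = (\<Sum>(a, b) \<in> pairs (supp f) (supp g) n. gcoeff f a * gcoeff g b)"
  unfolding times_gseries_def
proof (subst gcoeff_Abs_gseries[of "sumset (supp f) (supp g)"])
  show "wfp_on (sumset (supp f) (supp g)) (<)"
    by (intro wfp_on_sumset wfp_on_supp)
  fix n assume "n \<notin> sumset (supp f) (supp g)"
  then have "pairs (supp f) (supp g) n = {}"
    by (auto simp: pairs_def sumset_def)
  then show "(\<Sum>(a, b) \<in> pairs (supp f) (supp g) n. gcoeff f a * gcoeff g b) = 0"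
    by simp
qed simp

lemma gcoeff_mult:
  fixes f g :: "('a, 'b) gseries"
  assumes "wfp_on A (<)" "wfp_on B (<)" "supp f \<subseteq> A" "supp g \<subseteq> B"
  shows "gcoeff (f * g) n = (\<Sum>(a, b) \<in> pairs A B n. gcoeff f a * gcoeff g b)"
  unfolding gcoeff_mult_supp
proof (rule sum.mono_neutral_left)
  show "finite (pairs A B n)" using assms by (intro finite_pairs)
  show "pairs (supp f) (supp g) n \<subseteq> pairs A B n"
    using assms by (auto simp: pairs_def)
  show "\<forall>p\<in>pairs A B n - pairs (supp f) (supp g) n.
      (case p of (a, b) \<Rightarrow> gcoeff f a * gcoeff g b) = 0"
    by (auto simp: pairs_def supp_def)
qed

lemma supp_mult_subset:
  fixes f g :: "('a, 'b) gseries"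
  shows "supp (f * g) \<subseteq> sumset (supp f) (supp g)"
proof
  fix n assume "n \<in> supp (f * g)"
  then have "pairs (supp f) (supp g) n \<noteq> {}"
    by (auto simp: supp_def[of "f * g"] gcoeff_mult_supp)
  then show "n \<in> sumset (supp f) (supp g)"
    by (auto simp: pairs_def sumset_def)
qed

lemma gseries_mult_commute: "f * g = g * (f :: ('a, 'b) gseries)"
  by (rule gseries_eqI, unfold gcoeff_mult_supp,
      rule sum.reindex_bij_witness[of _ prod.swap prod.swap])
    (auto simp: pairs_def add.commute mult.commute)

lemma gseries_mult_assoc: "(f * g) * h = f * (g * (h :: ('a, 'b) gseries))"
proof (rule gseries_eqI)
  fix n
  let ?F = "supp f" and ?G = "supp g" and ?H = "supp h"
  note wf = wfp_on_supp wfp_on_sumset[OF wfp_on_supp wfp_on_supp]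
  have "gcoeff ((f * g) * h) n =
      (\<Sum>(d, c)\<in>pairs (sumset ?F ?G) ?H n. gcoeff (f * g) d * gcoeff h c)"
    by (rule gcoeff_mult) (use wf supp_mult_subset in auto)
  also have "\<dots> = (\<Sum>p\<in>pairs (sumset ?F ?G) ?H n. \<Sum>q\<in>pairs ?F ?G (fst p).
      gcoeff f (fst q) * gcoeff g (snd q) * gcoeff h (snd p))"
    by (simp add: gcoeff_mult_supp sum_distrib_right case_prod_unfold)
  also have "\<dots> = (\<Sum>(p, q)\<in>Sigma (pairs (sumset ?F ?G) ?H n) (\<lambda>p. pairs ?F ?G (fst p)).
      gcoeff f (fst q) * gcoeff g (snd q) * gcoeff h (snd p))"
    by (rule sum.Sigma) (auto intro!: finite_pairs wf)
  also have "\<dots> = (\<Sum>(p, q)\<in>Sigma (pairs ?F (sumset ?G ?H) n) (\<lambda>p. pairs ?G ?H (snd p)).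
      gcoeff f (fst p) * (gcoeff g (fst q) * gcoeff h (snd q)))"
    by (rule sum.reindex_bij_witness[of _
          "\<lambda>(p, q). ((fst p + fst q, snd q), (fst p, fst q))"
          "\<lambda>(p, q). ((fst q, snd q + snd p), (snd q, snd p))"])
      (fastforce simp: pairs_def sumset_def add.assoc mult.assoc)+
  also have "\<dots> = (\<Sum>p\<in>pairs ?F (sumset ?G ?H) n. \<Sum>q\<in>pairs ?G ?H (snd p).
      gcoeff f (fst p) * (gcoeff g (fst q) * gcoeff h (snd q)))"
    by (rule sum.Sigma[symmetric]) (auto intro!: finite_pairs wf)
  also have "\<dots> = (\<Sum>(a, d)\<in>pairs ?F (sumset ?G ?H) n. gcoeff f a * gcoeff (g * h) d)"
    by (simp add: gcoeff_mult_supp sum_distrib_left case_prod_unfold)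
  also have "\<dots> = gcoeff (f * (g * h)) n"
    by (rule gcoeff_mult[symmetric]) (use wf supp_mult_subset in auto)
  finally show "gcoeff ((f * g) * h) n = gcoeff (f * (g * h)) n" .
qed

instance
proof
  fix f g h :: "('a, 'b) gseries"
  show "f * g * h = f * (g * h)" by (rule gseries_mult_assoc)
  show "f * g = g * f" by (rule gseries_mult_commute)
  show "1 * f = f"
  proof (rule gseries_eqI)
    fix n
    have "supp (1 :: ('a, 'b) gseries) \<subseteq> {0}" by (auto simp: supp_def gcoeff_one)
    then have "gcoeff (1 * f) n = (\<Sum>(a, b)\<in>pairs {0} (supp f) n. gcoeff 1 a * gcoeff f b)"
      by (intro gcoeff_mult wfp_on_supp) (auto simp: wfp_on_def)
    also have "pairs {0} (supp f) n = (if n \<in> supp f then {(0, n)} else {})"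
      by (auto simp: pairs_def)
    finally show "gcoeff (1 * f) n = gcoeff f n"
      by (auto simp: gcoeff_one supp_def split: if_splits)
  qed
  show "(f + g) * h = f * h + g * h"
  proof (rule gseries_eqI)
    fix n
    let ?A = "supp f \<union> supp g"
    have A: "wfp_on ?A (<)" by (intro wfp_on_Un wfp_on_supp)
    have "supp (f + g) \<subseteq> ?A" by (auto simp: supp_def)
    then show "gcoeff ((f + g) * h) n = gcoeff (f * h + g * h) n"
      by (simp add: gcoeff_mult[OF A wfp_on_supp[of h]] sum.distrib[symmetric]
          case_prod_unfold distrib_right)
  qed
  show "(0 :: ('a, 'b) gseries) \<noteq> 1"
    by (metis gcoeff_group(1) gcoeff_one zero_neq_one)
qed

end


section \<open>Laurent polynomials, polynomials in \<open>y\<close>, and the valuation \<open>w\<close>\<close>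

text \<open>\<open>K[x\<^sub>1, x\<^sub>1\<^sup>-\<^sup>1, \<dots>, x\<^sub>r, x\<^sub>r\<^sup>-\<^sup>1]\<close>\<close>

type_synonym ('r, 'a) laurent = "'r mexp \<Rightarrow>\<^sub>0 'a"

definition xpow :: "'r mexp \<Rightarrow> ('r, 'a::zero_neq_one) laurent" where
  "xpow n = Poly_Mapping.single n 1"

definition series_of :: "('r::{finite,linorder}, 'a::zero) laurent \<Rightarrow> ('r mexp, 'a) gseries" where
  "series_of a = Abs_gseries (Poly_Mapping.lookup a)"

lemma gcoeff_series_of [simp]: "gcoeff (series_of a) = Poly_Mapping.lookup a"
  unfolding series_of_def
proof (rule gcoeff_Abs_gseries[of "Poly_Mapping.keys a"])
  show "wfp_on (Poly_Mapping.keys a) (<)"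
    by (intro strict_partial_order_wfp_on_finite_set) (auto intro: transpI asympI)
qed (simp add: in_keys_iff)

definition eval_y ::
  "('r::{finite,linorder}, 'a::comm_ring_1) laurent poly \<Rightarrow> ('r mexp, 'a) gseries \<Rightarrow> ('r mexp, 'a) gseries"
  where "eval_y Q t = poly (map_poly series_of Q) t"

definition val_x :: "('r::{finite,linorder}, 'a::zero) laurent \<Rightarrow> 'r mexp extended" where
  "val_x a = (if a = 0 then \<infinity> else Fin (Min (Poly_Mapping.keys a)))"

definition val_y :: "('r::{finite,linorder}, 'a::zero) laurent poly \<Rightarrow> 'r mexp extended" where
  "val_y Q = (MIN j\<in>{..degree Q}. val_x (coeff Q j))"

definition strongly_reduced_henselian :: "('r::{finite,linorder}, 'a::comm_ring_1) laurent poly \<Rightarrow> bool" where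
  "strongly_reduced_henselian Q \<longleftrightarrow> val_y Q > Fin 0 \<and> poly Q 0 \<noteq> 0"


section \<open>The objects attached to a polynomial and a root\<close>

definition z_trunc :: "('r::{finite,linorder} mexp, 'a::field) gseries \<Rightarrow> 'r mexp \<Rightarrow> ('r, 'a) laurent" where
  "z_trunc y0 k = (if k = 0 then 0
     else \<Sum>n | n \<in> nat_exps \<and> last_unit \<le> n \<and> n \<le> k. Poly_Mapping.single n (gcoeff y0 n))"

definition P_shift ::
  "('r::{finite,linorder}, 'a::field) laurent poly \<Rightarrow> ('r mexp, 'a) gseries \<Rightarrow> 'r mexp \<Rightarrow> ('r, 'a) laurent poly"
  where "P_shift P y0 k = pcompose P [:z_trunc y0 k, xpow (succ_exp k):]"

text \<open>\<open>w(P\<^sub>k)\<close> as an element of \<open>\<int>\<^sup>r\<close>; it is only finite when \<open>P\<^sub>k \<noteq> 0\<close>, i.e. \<open>P \<noteq> 0\<close>.\<close>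

definition i_idx ::
  "('r::{finite,linorder}, 'a::field) laurent poly \<Rightarrow> ('r mexp, 'a) gseries \<Rightarrow> 'r mexp \<Rightarrow> 'r mexp"
  where "i_idx P y0 k = (THE i. val_y (P_shift P y0 k) = Fin i)"

definition pi_poly ::
  "('r::{finite,linorder}, 'a::field) laurent poly \<Rightarrow> ('r mexp, 'a) gseries \<Rightarrow> 'r mexp \<Rightarrow> 'r mexp \<Rightarrow> 'a poly"
  where "pi_poly P y0 k i = map_poly (\<lambda>a. Poly_Mapping.lookup a i) (P_shift P y0 k)"

definition k_zero ::
  "('r::{finite,linorder}, 'a::field) laurent poly \<Rightarrow> ('r mexp, 'a) gseries \<Rightarrow> 'r mexp"
  where "k_zero P y0 = (LEAST k. k \<in> nat_exps \<and>
    i_idx P y0 (succ_exp k) = i_idx P y0 k - succ_exp k + succ_exp (succ_exp k))"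

definition omega_zero ::
  "('r::{finite,linorder}, 'a::field) laurent poly \<Rightarrow> ('r mexp, 'a) gseries \<Rightarrow> 'a"
  where "omega_zero P y0 =
    (let k0 = k_zero P y0 in
      poly (pderiv (pi_poly P y0 k0 (i_idx P y0 k0))) (gcoeff y0 (succ_exp k0)))"

text \<open>Division by \<open>-\<omega>\<^sub>0 x\<^sup>i\<close> is multiplication by the inverse monomial.\<close>

definition R_poly ::
  "('r::{finite,linorder}, 'a::field) laurent poly \<Rightarrow> ('r mexp, 'a) gseries \<Rightarrow> 'r mexp \<Rightarrow> ('r, 'a) laurent poly"
  where "R_poly P y0 k =
    smult (Poly_Mapping.single (- i_idx P y0 k) (1 / (- omega_zero P y0)))
      (pcompose (P_shift P y0 k) [:Poly_Mapping.single 0 (gcoeff y0 (succ_exp k)), 1:])"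

definition Q_poly ::
  "('r::{finite,linorder}, 'a::field) laurent poly \<Rightarrow> ('r mexp, 'a) gseries \<Rightarrow> 'r mexp \<Rightarrow> ('r, 'a) laurent poly"
  where "Q_poly P y0 k = R_poly P y0 k + [:0, 1:]"

text \<open>\<open>t\<^sub>m = (y\<^sub>0 - z\<^sub>m) / x\<^sup>m\<close>\<close>

definition t_tail :: "('r::{finite,linorder} mexp, 'a::field) gseries \<Rightarrow> 'r mexp \<Rightarrow> ('r mexp, 'a) gseries" where
  "t_tail y0 m = (y0 - series_of (z_trunc y0 m)) * series_of (xpow (- m))"

end

(*
  Expand P_k = x^{i_k} (pi_k(y) + higher terms). Since P_k vanishes at (y_0 - z_k) / x^{S(k)}, whose
  coefficient at 0 is c = c_{S(k)}, the polynomial pi_k has the root c; in particular it is not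
  constant. Put d = S^2(k) - S(k). As P_{S(k)}(y) = P_k(c + x^d y), the coefficients of y^j with
  j >= 2 vanish in P_{S(k)} at all exponents <= i_k + d, that of y^1 vanishes below i_k + d, and
  at i_k + d it is pi_k'(c). Since the lowest slice of P_{S(k)} is not constant either,
  i_{S(k)} >= i_k + d, with equality iff pi_k'(c) <> 0; in that case
  pi_{S(k)} = pi_k'(c) (y - c_{S^2(k)}). So beyond k_0 the lowest slice of P_k(y + c_{S(k)}) is
  omega_0 y, which is exactly the statement that the Henselian equation is strongly reduced.

  That k_0 exists follows from dP/dy(x, y_0) <> 0: if e is in its support and S(k) > e, then
  i_k <= e + S(k) < 2 S(k), so that pi_k has degree 1 and pi_k'(c) <> 0.
*)

theory Submission
  imports Defs
begin

section \<open>Exponents in \<open>nat_exps\<close>: least elements and iterated successors\<close>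

section \<open>Exponents\<close>

lemma total_deg_mono: "n \<le> m \<Longrightarrow> total_deg n \<le> total_deg m"
  by (auto simp: less_eq_mexp_def grlex_less_def)

lemma total_deg_nat_exps_eq_0:
  assumes "n \<in> nat_exps" "total_deg n \<le> 0"
  shows "n = 0"
proof -
  have "total_deg n = 0"
    using assms by (intro antisym) (auto simp: total_deg_def nat_exps_def intro!: sum_nonneg)
  then show ?thesis
    using assms by (intro mexp_eqI) (simp add: total_deg_def nat_exps_def sum_nonneg_eq_0_iff)
qed

lemma nat_exps_nonneg:
  assumes "n \<in> nat_exps"
  shows "0 \<le> n"
proof (rule ccontr)
  assume "\<not> 0 \<le> n"
  then have "total_deg n \<le> 0"
    using total_deg_mono[of n 0] by (simp add: total_deg_def)
  with assms \<open>\<not> 0 \<le> n\<close> show False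
    using total_deg_nat_exps_eq_0 by auto
qed

lemma total_deg_last_unit: "total_deg (last_unit :: 'r::{finite,linorder} mexp) = 1"
  by (simp add: total_deg_def last_unit_def)

text \<open>A smaller exponent would have degree 0 or first differ from \<open>last_unit\<close> in
  the last coordinate; either way it is 0. So the sums defining \<open>z_trunc\<close> lose no term
  of \<open>y0\<close>.\<close>

lemma last_unit_le:
  fixes n :: "'r::{finite,linorder} mexp"
  assumes "n \<in> nat_exps" "0 < n"
  shows "last_unit \<le> n"
proof (rule ccontr)
  assume "\<not> last_unit \<le> n"
  then have "grlex_less n last_unit"
    by (simp add: less_mexp_def not_le)
  then have "total_deg n \<le> 0 \<or> lex_less n last_unit"
    by (auto simp: grlex_less_def total_deg_last_unit)
  then show False
  proof
    assume "total_deg n \<le> 0"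
    then show False using total_deg_nat_exps_eq_0 assms by blast
  next
    assume "lex_less n last_unit"
    then obtain i where i: "mexp_nth n i < mexp_nth last_unit i"
      "\<forall>j<i. mexp_nth n j = mexp_nth last_unit j"
      by (auto simp: lex_less_def)
    have "0 \<le> mexp_nth n i" using assms(1) by (simp add: nat_exps_def)
    with i have "i = Max UNIV" "mexp_nth n i = 0"
      by (auto simp: last_unit_def split: if_splits)
    have "mexp_nth n j = 0" for j
    proof (cases "j = i")
      case False
      then have "j < i"
        using \<open>i = Max UNIV\<close> Max_ge[of UNIV j] by (simp add: order_less_le)
      with i(2) False \<open>i = Max UNIV\<close> show ?thesis by (simp add: last_unit_def)
    qed (use \<open>mexp_nth n i = 0\<close> in simp)
    then have "n = 0" by (intro mexp_eqI) simp
    with assms(2) show False by simp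
  qed
qed

lemma ex_nat_exps_greater:
  fixes k :: "'r::{finite,linorder} mexp"
  shows "\<exists>m\<in>nat_exps. k < m"
proof -
  \<comment> \<open>Degree is compared first, so one large coordinate suffices; the absolute value
    keeps it nonnegative for every \<open>k\<close>.\<close>
  define m :: "'r mexp" where "m = Mexp (\<lambda>i. if i = Max UNIV then \<bar>total_deg k\<bar> + 1 else 0)"
  have "total_deg m = \<bar>total_deg k\<bar> + 1"
    by (simp add: total_deg_def m_def)
  then have "\<not> m \<le> k" using total_deg_mono[of m k] by linarith
  moreover have "m \<in> nat_exps" by (auto simp: nat_exps_def m_def)
  ultimately show ?thesis by (auto simp: not_le)
qed

text \<open>All exponents together are not well-ordered; restricting to \<open>nat_exps\<close>
  makes \<open>LEAST\<close> meaningful, both for \<open>succ_exp\<close> and for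
  \<open>k_zero\<close>.\<close>

lemma Least_nat_exps:
  fixes Q :: "'r::{finite,linorder} mexp \<Rightarrow> bool"
  assumes "m \<in> nat_exps" "Q m"
  shows "(LEAST m. m \<in> nat_exps \<and> Q m) \<in> nat_exps \<and> Q (LEAST m. m \<in> nat_exps \<and> Q m)"
    and "(LEAST m. m \<in> nat_exps \<and> Q m) \<le> m"
proof -
  let ?B = "{m \<in> nat_exps. Q m}"
  have "?B \<subseteq> nat_exps" "?B \<noteq> {}" using assms by auto
  then obtain z where z: "z \<in> ?B" "\<forall>y. y < z \<longrightarrow> y \<notin> ?B"
    using wfp_on_nat_exps unfolding wfp_on_iff_ex_minimal by meson
  then have *: "(LEAST m. m \<in> nat_exps \<and> Q m) = z"
    by (intro Least_equality) (auto simp: not_less[symmetric])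
  show "(LEAST m. m \<in> nat_exps \<and> Q m) \<in> nat_exps \<and> Q (LEAST m. m \<in> nat_exps \<and> Q m)"
    using z(1) unfolding * by blast
  show "(LEAST m. m \<in> nat_exps \<and> Q m) \<le> m"
    using z(2) assms unfolding * by (auto simp: not_less[symmetric])
qed

lemma succ_exp_nat [simp]: "succ_exp k \<in> nat_exps"
  and less_succ_exp [simp]: "k < succ_exp k"
proof -
  obtain m where m: "m \<in> nat_exps" "k < m" using ex_nat_exps_greater by blast
  show "succ_exp k \<in> nat_exps" "k < succ_exp k"
    unfolding succ_exp_def using Least_nat_exps(1)[of m "\<lambda>m. k < m", OF m] by auto
qed

lemma succ_exp_le: "m \<in> nat_exps \<Longrightarrow> k < m \<Longrightarrow> succ_exp k \<le> m"
  unfolding succ_exp_def by (rule Least_nat_exps(2))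

text \<open>Only finitely many elements of \<open>nat_exps\<close> lie below \<open>n\<close>, and
  each successor step shrinks the set of those still ahead. Thus induction along successors reaches
  every later index.\<close>

lemma succ_exp_iter_reaches:
  fixes k n :: "'r::{finite,linorder} mexp"
  assumes "n \<in> nat_exps" "k \<le> n"
  shows "\<exists>m. n = (succ_exp ^^ m) k"
  using assms(2)
proof (induction "card {x \<in> nat_exps. k < x \<and> x \<le> n}" arbitrary: k rule: less_induct)
  case less
  show ?case
  proof (cases "k = n")
    case True
    then show ?thesis by (intro exI[of _ 0]) simp
  next
    case False
    then have k: "k < n" using less.prems by simp
    have "{x \<in> nat_exps. succ_exp k < x \<and> x \<le> n} \<subset> {x \<in> nat_exps. k < x \<and> x \<le> n}"
    proof
      show "{x \<in> nat_exps. succ_exp k < x \<and> x \<le> n} \<subseteq> {x \<in> nat_exps. k < x \<and> x \<le> n}"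
        using less_trans[OF less_succ_exp[of k]] by blast
      show "{x \<in> nat_exps. succ_exp k < x \<and> x \<le> n} \<noteq> {x \<in> nat_exps. k < x \<and> x \<le> n}"
        using succ_exp_le[OF assms(1) k] less_succ_exp[of k] succ_exp_nat[of k] by blast
    qed
    moreover have "finite {x \<in> nat_exps. k < x \<and> x \<le> n}"
      by (rule finite_subset[OF _ finite_nat_exps_le[of n]]) auto
    ultimately have "card {x \<in> nat_exps. succ_exp k < x \<and> x \<le> n}
        < card {x \<in> nat_exps. k < x \<and> x \<le> n}"
      by (intro psubset_card_mono)
    from less.hyps[OF this succ_exp_le[OF assms(1) k]]
    obtain m where "n = (succ_exp ^^ m) (succ_exp k)" by blast
    then have "n = (succ_exp ^^ Suc m) k" by (simp add: funpow_Suc_right del: funpow.simps)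
    then show ?thesis by blast
  qed
qed

lemma strict_mono_succ_exp_iter: "strict_mono (\<lambda>m. (succ_exp ^^ m) k)"
  by (simp add: strict_mono_Suc_iff)


section \<open>Lowest coefficients of products and the embedding of Laurent polynomials\<close>

section \<open>Series\<close>

text \<open>In an ordered group, \<open>x \<ge> a\<close>, \<open>y \<ge> b\<close> and
  \<open>x + y = a + b\<close> force equality, so at most one pair contributes. The bounds need not
  be attained.\<close>

lemma gcoeff_mult_lowest:
  fixes f g :: "('e::linordered_ab_group_add, 'a::comm_ring_1) gseries"
  assumes f: "\<And>n. n < a \<Longrightarrow> gcoeff f n = 0" and g: "\<And>n. n < b \<Longrightarrow> gcoeff g n = 0"
  shows "n < a + b \<Longrightarrow> gcoeff (f * g) n = 0"
    and "gcoeff (f * g) (a + b) = gcoeff f a * gcoeff g b"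
proof -
  have ge: "a \<le> x \<and> b \<le> y" if "(x, y) \<in> pairs (supp f) (supp g) n" for x y n
    using that f[of x] g[of y] by (auto simp: pairs_def supp_def not_less[symmetric])
  show "gcoeff (f * g) n = 0" if "n < a + b"
  proof -
    have "pairs (supp f) (supp g) n = {}"
    proof (rule ccontr)
      assume "pairs (supp f) (supp g) n \<noteq> {}"
      then obtain x y where xy: "(x, y) \<in> pairs (supp f) (supp g) n" by auto
      then have "x + y = n" by (simp add: pairs_def)
      with ge[OF xy] that show False using add_mono[of a x b y] by auto
    qed
    then show ?thesis by (simp add: gcoeff_mult_supp)
  qed
  have "pairs (supp f) (supp g) (a + b) \<subseteq> {(a, b)}"
  proof clarify
    fix x y assume xy: "(x, y) \<in> pairs (supp f) (supp g) (a + b)"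
    then have "x + y = a + b" by (simp add: pairs_def)
    moreover have "a \<le> x" "b \<le> y" using ge[OF xy] by auto
    ultimately show "x = a \<and> y = b"
      using add_less_le_mono[of a x b y] by (cases "a = x") (auto simp: order_le_less)
  qed
  then have "gcoeff (f * g) (a + b) = (\<Sum>(x, y)\<in>{(a, b)}. gcoeff f x * gcoeff g y)"
    unfolding gcoeff_mult_supp
    by (intro sum.mono_neutral_left) (auto simp: pairs_def supp_def)
  then show "gcoeff (f * g) (a + b) = gcoeff f a * gcoeff g b" by simp
qed

lemma series_of_0 [simp]: "series_of 0 = 0"
  by (rule gseries_eqI) simp

lemma series_of_1 [simp]: "series_of 1 = 1"
  by (rule gseries_eqI) (auto simp: gcoeff_one lookup_one when_def)

lemma series_of_add: "series_of (a + b) = series_of a + (series_of b :: (_, 'a::comm_ring_1) gseries)"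
  by (rule gseries_eqI) (simp add: lookup_add)

lemma supp_series_of: "supp (series_of a) = Poly_Mapping.keys a"
  by (auto simp: supp_def in_keys_iff)

text \<open>Both products are the same finite convolution; this transfers coefficient facts from
  series to Laurent polynomials.\<close>

lemma series_of_mult:
  fixes a b :: "('r::{finite,linorder}, 'a::comm_ring_1) laurent"
  shows "series_of (a * b) = series_of a * series_of b"
proof (rule gseries_eqI)
  fix n
  let ?A = "Poly_Mapping.keys a" and ?B = "Poly_Mapping.keys b"
  let ?f = "\<lambda>(x, y). (Poly_Mapping.lookup a x * Poly_Mapping.lookup b y when n = x + y)"
  have "Poly_Mapping.lookup (a * b) n = Sum_any ?f"
    by (simp add: times_poly_mapping.rep_eq prod_fun_unfold_prod)
  also have "\<dots> = sum ?f (?A \<times> ?B)"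
    by (rule Sum_any.expand_superset) (auto simp: in_keys_iff when_def split: if_splits)
  also have "\<dots> = (\<Sum>(x, y)\<in>pairs ?A ?B n. Poly_Mapping.lookup a x * Poly_Mapping.lookup b y)"
    by (rule sum.mono_neutral_cong_right) (auto simp: pairs_def when_def split: if_splits)
  finally show "gcoeff (series_of (a * b)) n = gcoeff (series_of a * series_of b) n"
    by (simp add: gcoeff_mult_supp supp_series_of)
qed

lemma gcoeff_single_mult:
  fixes f :: "('r::{finite,linorder} mexp, 'a::comm_ring_1) gseries"
  shows "gcoeff (series_of (Poly_Mapping.single m c) * f) n = c * gcoeff f (n - m)"
proof -
  have "supp (series_of (Poly_Mapping.single m c)) \<subseteq> {m}"
    by (auto simp: supp_def lookup_single when_def split: if_splits)
  then have "gcoeff (series_of (Poly_Mapping.single m c) * f) n =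
      (\<Sum>(a, b)\<in>pairs {m} (supp f) n. Poly_Mapping.lookup (Poly_Mapping.single m c) a * gcoeff f b)"
    by (subst gcoeff_mult[OF _ wfp_on_supp]) (auto simp: wfp_on_def)
  also have "pairs {m} (supp f) n = (if n - m \<in> supp f then {(m, n - m)} else {})"
    by (auto simp: pairs_def)
  finally show ?thesis by (auto simp: supp_def split: if_splits)
qed

lemma lookup_single_mult:
  fixes a :: "('r::{finite,linorder}, 'a::comm_ring_1) laurent"
  shows "Poly_Mapping.lookup (Poly_Mapping.single m c * a) n = c * Poly_Mapping.lookup a (n - m)"
  using gcoeff_single_mult[of m c "series_of a" n] by (simp flip: series_of_mult)

lemma xpow_mult: "xpow m * xpow n = (xpow (m + n) :: ('r, 'a::comm_ring_1) laurent)"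
  by (simp add: xpow_def mult_single)

lemma series_of_xpow_inverse:
  "series_of (xpow (- m)) * series_of (xpow m) = (1 :: ('r::{finite,linorder} mexp, 'a::comm_ring_1) gseries)"
  by (simp flip: series_of_mult add: xpow_mult) (simp add: xpow_def)

lemma gcoeff_mult_xpow:
  fixes f :: "('r::{finite,linorder} mexp, 'a::comm_ring_1) gseries"
  shows "gcoeff (f * series_of (xpow m)) n = gcoeff f (n - m)"
  by (simp add: xpow_def gcoeff_single_mult mult.commute[of f])


section \<open>Substitution of a series for \<open>y\<close> as a ring homomorphism\<close>

section \<open>Evaluation in \<open>y\<close>\<close>

lemma eval_y_0 [simp]: "eval_y 0 t = 0"
  by (simp add: eval_y_def)

lemma eval_y_pCons: "eval_y (pCons a p) t = series_of a + t * eval_y p t"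
  by (simp add: eval_y_def map_poly_pCons)

lemma eval_y_add: "eval_y (p + q) t = eval_y p t + eval_y q t"
proof -
  have "map_poly series_of (p + q) = map_poly series_of p + map_poly series_of q"
    by (rule poly_eqI) (simp add: coeff_map_poly series_of_add)
  then show ?thesis by (simp add: eval_y_def)
qed

lemma eval_y_smult: "eval_y (smult a p) t = series_of a * eval_y p t"
proof -
  have "map_poly series_of (smult a p) = smult (series_of a) (map_poly series_of p)"
    by (rule poly_eqI) (simp add: coeff_map_poly series_of_mult)
  then show ?thesis by (simp add: eval_y_def)
qed

lemma eval_y_mult: "eval_y (p * q) t = eval_y p t * eval_y q t"
  by (induction p) (simp_all add: eval_y_pCons eval_y_add eval_y_smult algebra_simps)

lemma eval_y_pcompose: "eval_y (pcompose p q) t = eval_y p (eval_y q t)"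
  by (induction p) (simp_all add: pcompose_pCons eval_y_pCons eval_y_add eval_y_mult)


section \<open>Coefficients of monomials in \<open>x\<close> as polynomials in \<open>y\<close>, and
  lowest exponents\<close>

section \<open>Slices of a polynomial in \<open>y\<close> along exponents in \<open>x\<close>\<close>

text \<open>Regards \<open>p\<close> as a Laurent polynomial in \<open>x\<close> over K[y]; for
  \<open>P_shift\<close> this gives the polynomials \<open>pi_poly\<close>.\<close>

definition slice :: "('r::{finite,linorder}, 'a::comm_ring_1) laurent poly \<Rightarrow> 'r mexp \<Rightarrow> 'a poly" where
  "slice p n = map_poly (\<lambda>a. Poly_Mapping.lookup a n) p"

lemma coeff_slice [simp]: "coeff (slice p n) j = Poly_Mapping.lookup (coeff p j) n"
  by (simp add: slice_def coeff_map_poly)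

lemma slice_eq_0_iff: "slice p n = 0 \<longleftrightarrow> (\<forall>j. Poly_Mapping.lookup (coeff p j) n = 0)"
  by (simp add: poly_eq_iff)

lemma slice_0 [simp]: "slice 0 n = 0"
  by (rule poly_eqI) simp

lemma slice_add: "slice (p + q) n = slice p n + slice q n"
  by (rule poly_eqI) (simp add: lookup_add)

lemma slice_pCons: "slice (pCons a p) n = pCons (Poly_Mapping.lookup a n) (slice p n)"
  by (rule poly_eqI) (simp add: coeff_pCons split: nat.split)

lemma slice_smult_single: "slice (smult (Poly_Mapping.single m c) p) n = smult c (slice p (n - m))"
  by (rule poly_eqI) (simp add: lookup_single_mult)

lemma slice_pderiv:
  fixes p :: "('r::{finite,linorder}, 'a::idom) laurent poly"
  shows "slice (pderiv p) n = pderiv (slice p n)"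
proof (rule poly_eqI)
  fix j
  have "Poly_Mapping.lookup (of_nat i * a) n = of_nat i * Poly_Mapping.lookup a n"
    for i and a :: "('r, 'a) laurent"
    by (induction i) (simp_all add: lookup_add distrib_right)
  from this[of "Suc j"] show "coeff (slice (pderiv p) n) j = coeff (pderiv (slice p n)) j"
    by (simp add: coeff_pderiv)
qed

text \<open>The bound w(p) >= i, in a form that also covers \<open>p = 0\<close> and an
  \<open>i\<close> that is not attained.\<close>

definition vanishes_below :: "('r::{finite,linorder}, 'a::comm_ring_1) laurent poly \<Rightarrow> 'r mexp \<Rightarrow> bool" where
  "vanishes_below p i \<longleftrightarrow> (\<forall>n<i. slice p n = 0)"

lemma vanishes_below_coeff:
  "vanishes_below p i \<Longrightarrow> n < i \<Longrightarrow> Poly_Mapping.lookup (coeff p j) n = 0"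
  by (simp add: vanishes_below_def slice_eq_0_iff)

lemma vanishes_below_pCons:
  "vanishes_below (pCons a p) i \<longleftrightarrow> (\<forall>n<i. Poly_Mapping.lookup a n = 0) \<and> vanishes_below p i"
  by (auto simp: vanishes_below_def slice_pCons)

lemma vanishes_below_add:
  "vanishes_below p i \<Longrightarrow> vanishes_below q i \<Longrightarrow> vanishes_below (p + q) i"
  by (simp add: vanishes_below_def slice_add)

lemma slice_mult_lowest:
  assumes p: "vanishes_below p a" and q: "vanishes_below q b"
  shows "vanishes_below (p * q) (a + b)" and "slice (p * q) (a + b) = slice p a * slice q b"
proof -
  have *: "n < a + b \<Longrightarrow> Poly_Mapping.lookup (coeff p i * coeff q j) n = 0"
    "Poly_Mapping.lookup (coeff p i * coeff q j) (a + b) =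
      Poly_Mapping.lookup (coeff p i) a * Poly_Mapping.lookup (coeff q j) b" for i j n
    using gcoeff_mult_lowest[of a "series_of (coeff p i)" b "series_of (coeff q j)"]
      vanishes_below_coeff[OF p] vanishes_below_coeff[OF q]
    by (simp_all flip: series_of_mult)
  show "vanishes_below (p * q) (a + b)"
    unfolding vanishes_below_def
    by (intro allI impI poly_eqI) (simp add: coeff_mult lookup_sum *)
  show "slice (p * q) (a + b) = slice p a * slice q b"
    by (rule poly_eqI) (simp add: coeff_mult lookup_sum *)
qed

text \<open>Horner's scheme: a factor \<open>q\<close> without negative exponents keeps the bound
  \<open>i\<close> and multiplies the slice at \<open>i\<close> by its own slice at 0.\<close>

lemma slice_pcompose_lowest:
  assumes "vanishes_below p i" "vanishes_below q 0"
  shows "vanishes_below (pcompose p q) i \<and> slice (pcompose p q) i = pcompose (slice p i) (slice q 0)"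
  using assms(1)
proof (induction p)
  case (pCons a p)
  then have a: "vanishes_below [:a:] i" and p: "vanishes_below p i"
    by (auto simp: vanishes_below_pCons vanishes_below_def[of 0])
  show ?case
    using pCons.IH[OF p] slice_mult_lowest[OF assms(2), of "pcompose p q" i] a
    by (auto simp: pcompose_pCons slice_add slice_pCons intro!: vanishes_below_add)
qed (simp add: vanishes_below_def)

text \<open>The same Horner induction for a series. If \<open>u\<close> is a root of
  \<open>p\<close>, its coefficient at 0 becomes a root of the slice at \<open>i\<close>.\<close>

lemma gcoeff_eval_y_lowest:
  assumes "vanishes_below p i" and u: "\<And>n. n < 0 \<Longrightarrow> gcoeff u n = 0"
  shows "(\<forall>n<i. gcoeff (eval_y p u) n = 0) \<and> gcoeff (eval_y p u) i = poly (slice p i) (gcoeff u 0)"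
  using assms(1)
proof (induction p)
  case (pCons a p)
  then have a: "\<forall>n<i. Poly_Mapping.lookup a n = 0" and p: "vanishes_below p i"
    by (auto simp: vanishes_below_pCons)
  show ?case
    using pCons.IH[OF p] gcoeff_mult_lowest[of 0 u i "eval_y p u", OF u] a
    by (simp add: eval_y_pCons slice_pCons)
qed simp

text \<open>The substituted coefficients are constant in \<open>x\<close>, so every slice is
  translated separately, not only the lowest.\<close>

lemma slice_pcompose_const:
  fixes p :: "('r::{finite,linorder}, 'a::comm_ring_1) laurent poly"
  shows "slice (pcompose p [:Poly_Mapping.single 0 c, 1:]) n = pcompose (slice p n) [:c, 1:]"
proof (induction p)
  case (pCons a p)
  have "[:Poly_Mapping.single 0 c, 1:] * q = smult (Poly_Mapping.single 0 c) q + pCons 0 q"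
    for q :: "('r, 'a) laurent poly" by simp
  with pCons show ?case
    by (simp add: pcompose_pCons slice_add slice_pCons slice_smult_single)
qed simp

lemma xpow_power: "(xpow d :: ('r, 'a::comm_ring_1) laurent) ^ j = xpow (\<Sum>_<j. d)"
proof (induction j)
  case 0
  then show ?case by (simp add: xpow_def)
next
  case (Suc j)
  then show ?case by (simp add: xpow_mult add.commute)
qed

text \<open>Rescaling \<open>y\<close> by \<open>x^d\<close> raises the exponents at
  \<open>y^j\<close> by \<open>j d\<close>, written as a sum of \<open>j\<close> copies; this
  separates \<open>j = 1\<close> from \<open>j \<ge> 2\<close>.\<close>

lemma lookup_coeff_pcompose_xpow:
  fixes p :: "('r::{finite,linorder}, 'a::comm_ring_1) laurent poly"
  shows "Poly_Mapping.lookup (coeff (pcompose p [:0, xpow d:]) j) n =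
     Poly_Mapping.lookup (coeff p j) (n - (\<Sum>_<j. d))"
  by (simp add: coeff_pcompose_linear xpow_power) (simp add: xpow_def lookup_single_mult)

lemma sum_const_mexp_ge:
  fixes d :: "'r::{finite,linorder} mexp" and j :: nat
  assumes "0 \<le> d" "j \<ge> 2"
  shows "d + d \<le> (\<Sum>_<j. d)"
  using assms(2)
proof (induction j rule: dec_induct)
  case base
  then show ?case by (simp add: numeral_2_eq_2)
next
  case (step j)
  then show ?case using add_mono[of "d + d" "\<Sum>_<j. d" 0 d] assms(1) by simp
qed

lemma val_y_eq_FinI:
  fixes p :: "('r::{finite,linorder}, 'a::comm_ring_1) laurent poly"
  assumes "vanishes_below p i" "slice p i \<noteq> 0"
  shows "val_y p = Fin i"
proof -
  have ge: "Fin i \<le> val_x (coeff p j)" for j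
  proof (cases "coeff p j = 0")
    case False
    then have "i \<le> Min (Poly_Mapping.keys (coeff p j))"
      using vanishes_below_coeff[OF assms(1), of _ j]
      by (subst Min_ge_iff) (auto simp: in_keys_iff not_less[symmetric])
    with False show ?thesis by (simp add: val_x_def)
  qed (simp add: val_x_def)
  from assms(2) obtain j where j: "Poly_Mapping.lookup (coeff p j) i \<noteq> 0"
    by (auto simp: slice_eq_0_iff)
  then have "i \<in> Poly_Mapping.keys (coeff p j)" "coeff p j \<noteq> 0"
    by (auto simp: in_keys_iff)
  then have "val_x (coeff p j) = Fin i"
    using ge[of j] Min_le[of "Poly_Mapping.keys (coeff p j)" i]
    by (auto simp: val_x_def intro!: antisym)
  \<comment> \<open>The minimum in \<open>val_y\<close> only ranges up to the degree, so this index
    must be seen to take part.\<close>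
  moreover have "j \<le> degree p"
    using \<open>coeff p j \<noteq> 0\<close> by (rule le_degree)
  ultimately show ?thesis
    unfolding val_y_def using ge by (intro Min_eqI) force+
qed

text \<open>Only finitely many exponents occur, so a least one exists although the exponents at
  large are not well-ordered.\<close>

lemma ex_lowest_slice:
  fixes p :: "('r::{finite,linorder}, 'a::comm_ring_1) laurent poly"
  assumes "p \<noteq> 0"
  shows "\<exists>i. vanishes_below p i \<and> slice p i \<noteq> 0"
proof -
  let ?N = "{n. slice p n \<noteq> 0}"
  have "?N \<subseteq> (\<Union>j\<le>degree p. Poly_Mapping.keys (coeff p j))"
  proof
    fix n assume "n \<in> ?N"
    then obtain j where "Poly_Mapping.lookup (coeff p j) n \<noteq> 0"
      by (auto simp: slice_eq_0_iff)
    moreover from this have "j \<le> degree p" by (intro le_degree) auto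
    ultimately show "n \<in> (\<Union>j\<le>degree p. Poly_Mapping.keys (coeff p j))"
      by (auto simp: in_keys_iff)
  qed
  then have fin: "finite ?N" by (rule finite_subset) simp
  have "?N \<noteq> {}"
  proof
    assume "?N = {}"
    then have "slice p n = 0" for n by auto
    then have "p = 0"
      by (intro poly_eqI poly_mapping_eqI) (simp add: slice_eq_0_iff)
    with assms show False by simp
  qed
  with fin have "Min ?N \<in> ?N" by (rule Min_in)
  then have "slice p (Min ?N) \<noteq> 0" by simp
  moreover have "slice p n = 0" if "n < Min ?N" for n
  proof (rule ccontr)
    assume "slice p n \<noteq> 0"
    then have "Min ?N \<le> n" by (intro Min_le fin) simp
    with that show False by simp
  qed
  ultimately show ?thesis unfolding vanishes_below_def by blast
qed

lemma val_y_gtI: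
  fixes p :: "('r::{finite,linorder}, 'a::comm_ring_1) laurent poly"
  assumes "\<And>n. n \<le> i \<Longrightarrow> slice p n = 0" "p \<noteq> 0"
  shows "val_y p > Fin i"
proof -
  obtain m where m: "vanishes_below p m" "slice p m \<noteq> 0"
    using ex_lowest_slice[OF assms(2)] by blast
  then have "i < m" using assms(1)[of m] by (meson not_le)
  with val_y_eq_FinI[OF m] show ?thesis by simp
qed


section \<open>Truncations of the root, shifted polynomials and their lowest slices\<close>

section \<open>Shifted polynomials along a root\<close>

text \<open>The support condition absorbs both the lower summation bound and the separate case
  \<open>k = 0\<close>: truncation is a plain cut at \<open>k\<close>.\<close>

lemma lookup_z_trunc:
  fixes y0 :: "('r::{finite,linorder} mexp, 'a::field) gseries"
  assumes y0: "supp y0 \<subseteq> {n \<in> nat_exps. n > 0}"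
  shows "Poly_Mapping.lookup (z_trunc y0 k) n = (if n \<le> k then gcoeff y0 n else 0)"
proof -
  let ?I = "{n \<in> nat_exps. last_unit \<le> n \<and> n \<le> k}"
  have zero: "gcoeff y0 n = 0" if "n \<notin> nat_exps \<or> \<not> last_unit \<le> n" for n
    using y0 that last_unit_le[of n] by (auto simp: supp_def)
  show ?thesis
  proof (cases "k = 0")
    case True
    moreover have "gcoeff y0 n = 0" if "n \<le> 0"
      using y0 that by (auto simp: supp_def)
    ultimately show ?thesis by (simp add: z_trunc_def)
  next
    case False
    have fin: "finite ?I"
      by (rule finite_subset[OF _ finite_nat_exps_le[of k]]) auto
    have "Poly_Mapping.lookup (z_trunc y0 k) n = (\<Sum>m\<in>?I. if m = n then gcoeff y0 n else 0)"
      using False by (auto simp: z_trunc_def lookup_sum lookup_single when_def intro!: sum.cong)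
    also have "\<dots> = (if n \<in> ?I then gcoeff y0 n else 0)"
      using fin by simp
    finally show ?thesis using zero[of n] by auto
  qed
qed

text \<open>Simplicity of the root is an assumption of single lemmas; polynomiality in
  \<open>x\<close> enters as the absence of negative exponents.\<close>

locale power_series_root =
  fixes P :: "('r::{finite,linorder}, 'a::field) laurent poly"
    and y0 :: "('r mexp, 'a) gseries"
  assumes P_nonzero: "P \<noteq> 0"
    and P_integral: "vanishes_below P 0"
    and y0_supp: "supp y0 \<subseteq> {n \<in> nat_exps. n > 0}"
    and root: "eval_y P y0 = 0"
begin

abbreviation "S \<equiv> (succ_exp :: 'r mexp \<Rightarrow> 'r mexp)"
abbreviation "c k \<equiv> gcoeff y0 (S k)"
abbreviation "A k \<equiv> P_shift P y0 k"
abbreviation "idx k \<equiv> i_idx P y0 k"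
text \<open>\<open>lead k\<close> is the lowest polynomial in \<open>y\<close>, \<open>B k\<close>
  the numerator of \<open>R_poly\<close>, and \<open>slope k\<close> is omega_0 at
  \<open>k = k_zero P y0\<close>.\<close>

abbreviation "lead k \<equiv> slice (A k) (idx k)"
abbreviation "B k \<equiv> pcompose (A k) [:Poly_Mapping.single 0 (c k), 1:]"
abbreviation "slope k \<equiv> poly (pderiv (lead k)) (c k)"
abbreviation "step k \<equiv> S (S k) - S k"

lemmas lookup_z = lookup_z_trunc[OF y0_supp]

lemma z_trunc_succ: "z_trunc y0 (S k) = z_trunc y0 k + Poly_Mapping.single (S k) (c k)"
proof (rule poly_mapping_eqI)
  fix n
  have "n \<le> k \<or> n = S k" if "n \<le> S k" "gcoeff y0 n \<noteq> 0"
  proof -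
    have "n \<in> nat_exps" using that y0_supp by (auto simp: supp_def)
    then show ?thesis using succ_exp_le[of n k] that by force
  qed
  moreover have "n \<le> S k" if "n \<le> k"
    using that less_succ_exp[of k] by (rule order_trans[OF _ less_imp_le])
  moreover have "\<not> S k \<le> k"
    by (simp add: not_le)
  ultimately show "Poly_Mapping.lookup (z_trunc y0 (S k)) n =
      Poly_Mapping.lookup (z_trunc y0 k + Poly_Mapping.single (S k) (c k)) n"
    by (auto simp: lookup_z lookup_add lookup_single when_def)
qed

text \<open>Shifting \<open>y\<close> by the next coefficient turns z_k into z_{S(k)} but keeps the
  scale x^{S(k)}; only that scale separates \<open>B k\<close> from \<open>A (S k)\<close>.\<close>

lemma B_eq: "B k = pcompose P [:z_trunc y0 (S k), xpow (S k):]"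
  by (simp add: P_shift_def pcompose_assoc[symmetric] z_trunc_succ pcompose_pCons)
    (simp add: xpow_def mult_single)

lemma A_succ: "A (S k) = pcompose (B k) [:0, xpow (step k):]"
  unfolding B_eq unfolding P_shift_def
  by (simp add: pcompose_assoc[symmetric] pcompose_pCons xpow_mult)

lemma lookup_A_succ:
  "Poly_Mapping.lookup (coeff (A (S k)) j) n = Poly_Mapping.lookup (coeff (B k) j) (n - (\<Sum>_<j. step k))"
  by (simp add: A_succ lookup_coeff_pcompose_xpow)

text \<open>As x^{S(k)} is nonzero, the substituted polynomial has degree 1 in \<open>y\<close>;
  over a domain such a substitution kills no nonzero polynomial.\<close>

lemma A_nonzero: "A k \<noteq> 0"
proof
  assume "A k = 0"
  moreover have "xpow (S k) \<noteq> (0 :: ('r, 'a) laurent)"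
    by (simp add: xpow_def) (metis lookup_single_eq lookup_zero zero_neq_one)
  ultimately have "P = 0"
    unfolding P_shift_def by (elim pcompose_eq_0) simp
  with P_nonzero show False by simp
qed

lemma A_below: "vanishes_below (A k) (idx k)" and lead_nonzero: "lead k \<noteq> 0"
proof -
  obtain i where i: "vanishes_below (A k) i" "slice (A k) i \<noteq> 0"
    using ex_lowest_slice[OF A_nonzero] by blast
  have "val_y (A k) = Fin i" using val_y_eq_FinI[OF i] .
  then have "idx k = i" by (simp add: i_idx_def)
  with i show "vanishes_below (A k) (idx k)" "lead k \<noteq> 0" by auto
qed

lemma idx_eqI: "vanishes_below (A k) i \<Longrightarrow> slice (A k) i \<noteq> 0 \<Longrightarrow> idx k = i"
  using val_y_eq_FinI[of "A k" i] by (simp add: i_idx_def)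

text \<open>Solves y0 = z_k + x^{S(k)} u_k, hence is a root of \<open>A k\<close>. Its coefficient
  at 0 is \<open>c k\<close>, a term that \<open>t_tail y0 (S k)\<close> has removed.\<close>

definition u :: "'r mexp \<Rightarrow> ('r mexp, 'a) gseries" where
  "u k = (y0 - series_of (z_trunc y0 k)) * series_of (xpow (- S k))"

lemma gcoeff_u: "gcoeff (u k) n = (if n + S k \<le> k then 0 else gcoeff y0 (n + S k))"
  by (simp add: u_def gcoeff_mult_xpow lookup_z)

text \<open>Exponents of \<open>y0\<close> above \<open>k\<close> are at least \<open>S k\<close>,
  so division by x^{S(k)} leaves none negative.\<close>

lemma u_neg: "n < 0 \<Longrightarrow> gcoeff (u k) n = 0"
proof -
  assume "n < 0"
  then have "n + S k < S k" by simp
  then have "n + S k \<in> nat_exps \<Longrightarrow> n + S k \<le> k"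
    using succ_exp_le[of "n + S k" k] by force
  then show ?thesis using y0_supp by (auto simp: gcoeff_u supp_def)
qed

lemma u_0: "gcoeff (u k) 0 = c k"
  using less_succ_exp[of k] by (auto simp: gcoeff_u simp del: less_succ_exp)

lemma shift_u: "eval_y [:z_trunc y0 k, xpow (S k):] (u k) = y0"
  by (simp add: eval_y_pCons u_def mult.assoc series_of_xpow_inverse)

lemma eval_A_u: "eval_y (A k) (u k) = 0"
  by (simp only: P_shift_def eval_y_pcompose shift_u root)

lemma lead_root: "poly (lead k) (c k) = 0"
  using gcoeff_eval_y_lowest[OF A_below u_neg, of k k] by (simp add: eval_A_u u_0)

lemma lead_not_const: "\<exists>j\<ge>1. coeff (lead k) j \<noteq> 0"
proof (rule ccontr)
  assume "\<not> ?thesis"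
  then have "lead k = [:coeff (lead k) 0:]"
    by (intro poly_eqI) (auto simp: coeff_pCons split: nat.split)
  then show False using lead_root[of k] lead_nonzero[of k]
    by (metis mult_zero_right add.right_neutral pCons_0_0 poly_0 poly_pCons)
qed

lemma slice_B: "slice (B k) n = pcompose (slice (A k) n) [:c k, 1:]"
  by (rule slice_pcompose_const)

lemma B_below: "vanishes_below (B k) (idx k)"
  using A_below[of k] by (simp add: vanishes_below_def slice_B)

lemma lookup_B_below: "n < idx k \<Longrightarrow> Poly_Mapping.lookup (coeff (B k) j) n = 0"
  using vanishes_below_coeff[OF B_below] .

lemma coeff_1_pcompose_const: "coeff (pcompose p [:a, 1:]) 1 = poly (pderiv p) (a :: 'a)"
proof -
  have "coeff (pcompose p [:a, 1:]) 1 = poly (pderiv (pcompose p [:a, 1:])) 0"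
    by (simp add: poly_0_coeff_0 coeff_pderiv)
  also have "\<dots> = poly (pderiv p) a"
    by (simp add: pderiv_pcompose poly_pcompose pderiv_pCons)
  finally show ?thesis .
qed

lemma lookup_B_1: "Poly_Mapping.lookup (coeff (B k) 1) (idx k) = slope k"
  by (simp only: slice_B coeff_1_pcompose_const flip: coeff_slice)

section \<open>Change of the lowest exponent and slice from \<open>k\<close> to
  \<open>S k\<close>\<close>

lemma step_pos: "0 < step k"
  by simp

text \<open>This coefficient is one of \<open>B k\<close>, with exponent lowered by \<open>j\<close>
  copies of \<open>step k\<close>. For \<open>j \<ge> 2\<close> that lands below
  \<open>idx k\<close>, where \<open>B k\<close> vanishes.\<close>

lemma coeff_lead_succ_high:
  assumes "n \<le> idx k + step k" "j \<ge> 2"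
  shows "Poly_Mapping.lookup (coeff (A (S k)) j) n = 0"
proof -
  have "n < idx k + (step k + step k)"
    using assms(1) step_pos[of k] by (metis add.assoc add.right_neutral add_strict_left_mono order_le_less_trans)
  also have "\<dots> \<le> idx k + (\<Sum>_<j. step k)"
    by (intro add_left_mono sum_const_mexp_ge less_imp_le step_pos assms)
  finally show ?thesis
    by (simp only: lookup_A_succ) (rule lookup_B_below, simp add: less_diff_eq diff_less_eq add.commute)
qed

lemma lookup_A_succ_1: "Poly_Mapping.lookup (coeff (A (S k)) 1) n = Poly_Mapping.lookup (coeff (B k) 1) (n - step k)"
  using lookup_A_succ[of k 1 n] by simp

text \<open>Below \<open>idx k + step k\<close> all coefficients of positive powers of
  \<open>y\<close> vanish, whereas a lowest slice is never constant.\<close>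

lemma idx_succ_ge: "idx k + step k \<le> idx (S k)"
proof (rule ccontr)
  assume "\<not> ?thesis"
  then have less: "idx (S k) < idx k + step k" by simp
  then have "idx (S k) - step k < idx k" by (simp add: diff_less_eq)
  then have "coeff (lead (S k)) 1 = 0"
    using lookup_B_below by (simp add: lookup_A_succ_1 del: One_nat_def)
  moreover have "coeff (lead (S k)) j = 0" if "j \<ge> 2" for j
    using coeff_lead_succ_high[OF less_imp_le[OF less] that] by simp
  moreover obtain j where "j \<ge> 1" "coeff (lead (S k)) j \<noteq> 0"
    using lead_not_const by blast
  ultimately show False by (cases "j = 1") auto
qed

text \<open>The coefficient of \<open>y\<close> is read off \<open>B k\<close> at
  \<open>idx k\<close>, where Taylor expansion identifies it with \<open>slope k\<close>. The
  exponent need not be the lowest.\<close>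

lemma slice_succ:
  "slice (A (S k)) (idx k + step k) =
    [:Poly_Mapping.lookup (coeff (A (S k)) 0) (idx k + step k), slope k:]"
proof (rule poly_eqI)
  fix j :: nat
  consider "j = 0" | "j = 1" | "j \<ge> 2" by linarith
  then show "coeff (slice (A (S k)) (idx k + step k)) j =
      coeff [:Poly_Mapping.lookup (coeff (A (S k)) 0) (idx k + step k), slope k:] j"
  proof cases
    case 2
    then show ?thesis using lookup_A_succ_1[of k "idx k + step k"] lookup_B_1[of k] by simp
  next
    case 3
    then show ?thesis
      using coeff_lead_succ_high[of "idx k + step k" k j] by (simp add: coeff_pCons split: nat.split)
  qed simp
qed

text \<open>Zero slope would make the slice constant, which no lowest slice is; nonzero slope makes
  it nonzero, and \<open>idx_succ_ge\<close> then makes it lowest.\<close>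

lemma idx_succ_eq_iff: "idx (S k) = idx k + step k \<longleftrightarrow> slope k \<noteq> 0"
proof
  assume eq: "idx (S k) = idx k + step k"
  show "slope k \<noteq> 0"
  proof
    assume "slope k = 0"
    then have "lead (S k) = [:coeff (lead (S k)) 0:]"
      using slice_succ[of k] unfolding eq by (metis coeff_pCons_0 pCons_0_0)
    then show False
      using lead_not_const[of "S k"] by (metis coeff_pCons_Suc coeff_0 not0_implies_Suc not_one_le_zero)
  qed
next
  assume "slope k \<noteq> 0"
  moreover have "vanishes_below (A (S k)) (idx k + step k)"
    using A_below[of "S k"] idx_succ_ge[of k] by (auto simp: vanishes_below_def intro: less_le_trans)
  ultimately show "idx (S k) = idx k + step k"
    by (intro idx_eqI) (auto simp: slice_succ)
qed

text \<open>A linear lowest slice has constant derivative, so its slope no longer depends on the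
  root where it is taken: once nonzero, the slope persists.\<close>

lemma lead_succ:
  assumes "slope k \<noteq> 0"
  shows "\<exists>b. lead (S k) = [:b, slope k:]" "slope (S k) = slope k"
proof -
  have "idx (S k) = idx k + step k" using assms by (simp add: idx_succ_eq_iff)
  then show *: "\<exists>b. lead (S k) = [:b, slope k:]" using slice_succ by simp
  then show "slope (S k) = slope k" by (auto simp: pderiv_pCons)
qed

lemma slope_iter:
  assumes "slope k \<noteq> 0"
  shows "slope ((S ^^ m) k) = slope k"
proof (induction m)
  case (Suc m)
  then show ?case using lead_succ(2)[of "(S ^^ m) k"] assms by simp
qed simp

section \<open>Existence of the threshold index and the lowest slice beyond it\<close>

lemma ex_slope_nonzero:
  assumes simple: "eval_y (pderiv P) y0 \<noteq> 0"
  shows "\<exists>k\<in>nat_exps. slope k \<noteq> 0"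
proof -
  let ?D = "eval_y (pderiv P) y0"
  obtain e where e: "gcoeff ?D e \<noteq> 0"
    using simple by (metis gcoeff_group(1) gseries_eqI)
  \<comment> \<open>The choice \<open>e < k\<close> gives \<open>e + S k < S k + S k\<close>, which
    stays below the terms of degree at least 2 in \<open>y\<close>.\<close>
  obtain k where k: "k \<in> nat_exps" "e < k" using ex_nat_exps_greater by blast
  define m where "m = S k"
  have m: "e < m" "0 \<le> m"
    using k less_succ_exp[of k] unfolding m_def by (auto intro: nat_exps_nonneg less_trans)
  \<comment> \<open>\<open>C\<close> is P(x, z_k + y) before rescaling. It has no negative
    exponents, so in \<open>A k\<close> the powers \<open>y^j\<close> with \<open>j \<ge> 2\<close>
    start at \<open>m + m\<close> or later.\<close>
  define C where "C = pcompose P [:z_trunc y0 k, 1:]"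
  have "vanishes_below [:z_trunc y0 k, 1:] 0"
    unfolding vanishes_below_def
  proof (intro allI impI)
    fix n :: "'r mexp" assume "n < 0"
    then have "gcoeff y0 n = 0" using y0_supp nat_exps_nonneg[of n] by (auto simp: supp_def)
    with \<open>n < 0\<close> show "slice [:z_trunc y0 k, 1:] n = 0"
      by (simp add: slice_pCons lookup_z lookup_one)
  qed
  then have C: "vanishes_below C 0"
    unfolding C_def using slice_pcompose_lowest P_integral by blast
  have A_eq: "A k = pcompose C [:0, xpow m:]"
    by (simp add: P_shift_def C_def m_def pcompose_assoc[symmetric] pcompose_pCons)
  have high: "Poly_Mapping.lookup (coeff (A k) j) n = 0" if "n < m + m" "j \<ge> 2" for j n
  proof -
    have "n < (\<Sum>_<j. m)" using that sum_const_mexp_ge[OF m(2)] by (meson less_le_trans)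
    then show ?thesis
      unfolding A_eq lookup_coeff_pcompose_xpow by (intro vanishes_below_coeff[OF C]) simp
  qed
  have deriv: "vanishes_below (pderiv (A k)) (idx k)"
    using A_below[of k] by (simp add: vanishes_below_def slice_pderiv)
  \<comment> \<open>Chain rule: the derivative of \<open>A k\<close> at \<open>u k\<close> is
    \<open>?D\<close> times x^m, so the exponent \<open>e\<close> of \<open>?D\<close> forces
    \<open>idx k \<le> e + m\<close>.\<close>
  have "eval_y (pderiv (A k)) (u k) = ?D * series_of (xpow m)"
    by (simp add: P_shift_def m_def pderiv_pcompose eval_y_mult eval_y_smult
        eval_y_pcompose shift_u pderiv_pCons mult.commute[of "series_of _"])
  then have "gcoeff (eval_y (pderiv (A k)) (u k)) (e + m) \<noteq> 0"
    using e by (simp add: gcoeff_mult_xpow)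
  then have "idx k \<le> e + m"
    using gcoeff_eval_y_lowest[OF deriv u_neg, of k] by (meson not_le)
  also have "\<dots> < m + m" using m by simp
  finally have idx: "idx k < m + m" .
  have lin: "lead k = [:coeff (lead k) 0, coeff (lead k) 1:]"
    by (rule poly_eqI) (use high[OF idx] in \<open>auto simp: coeff_pCons split: nat.split\<close>)
  have "coeff (lead k) 1 \<noteq> 0"
  proof
    assume "coeff (lead k) 1 = 0"
    moreover obtain j where "j \<ge> 1" "coeff (lead k) j \<noteq> 0" using lead_not_const by blast
    ultimately show False using high[OF idx, of j] by (cases "j = 1") auto
  qed
  moreover have "slope k = coeff (lead k) 1"
    by (subst lin) (simp add: pderiv_pCons)
  ultimately have "slope k \<noteq> 0" by metis
  with k(1) show ?thesis by blast
qed

text \<open>Turns \<open>k_zero\<close> into the least index with nonzero slope.\<close>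

lemma idx_condition: "idx (S k) = idx k - S k + S (S k) \<longleftrightarrow> slope k \<noteq> 0"
  using idx_succ_eq_iff[of k] by (simp add: algebra_simps)

lemma omega_zero_eq: "omega_zero P y0 = slope (k_zero P y0)"
  by (simp add: omega_zero_def pi_poly_def slice_def Let_def)

lemma k_zero:
  assumes "eval_y (pderiv P) y0 \<noteq> 0"
  shows "k_zero P y0 \<in> nat_exps" "omega_zero P y0 \<noteq> 0"
proof -
  obtain k where "k \<in> nat_exps" "slope k \<noteq> 0"
    using ex_slope_nonzero[OF assms] by blast
  from Least_nat_exps(1)[of k "\<lambda>k. slope k \<noteq> 0", OF this]
  show "k_zero P y0 \<in> nat_exps" "omega_zero P y0 \<noteq> 0"
    unfolding omega_zero_eq by (simp_all add: k_zero_def idx_condition)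
qed

lemma slice_B_after_k_zero:
  assumes "eval_y (pderiv P) y0 \<noteq> 0" "k \<in> nat_exps" "k_zero P y0 < k"
  shows "slice (B k) (idx k) = [:0, omega_zero P y0:]"
proof -
  let ?k0 = "k_zero P y0" and ?w = "omega_zero P y0"
  obtain m where m: "k = (S ^^ m) ?k0"
    using succ_exp_iter_reaches[OF assms(2) less_imp_le[OF assms(3)]] by blast
  with assms(3) obtain l where l: "m = Suc l" by (cases m) auto
  \<comment> \<open>Lying strictly beyond \<open>k_zero\<close> provides a predecessor of
    \<open>k\<close>; \<open>lead_succ\<close> yields a linear slice only one step after the slope
    is nonzero.\<close>
  have w: "slope ((S ^^ l) ?k0) = ?w"
    using k_zero(2)[OF assms(1)] slope_iter[of ?k0 l] by (simp add: omega_zero_eq)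
  obtain b where b: "lead k = [:b, ?w:]"
    using lead_succ(1)[of "(S ^^ l) ?k0"] k_zero(2)[OF assms(1)] m l w by auto
  \<comment> \<open>The root condition cancels the constant term after translation by
    \<open>c k\<close>.\<close>
  then have "b + c k * ?w = 0" using lead_root[of k] by simp
  then show ?thesis by (simp add: slice_B b pcompose_pCons mult.commute)
qed

section \<open>The Henselian equation and its solution\<close>

lemma henselian_equation:
  assumes "eval_y (pderiv P) y0 \<noteq> 0" "k \<in> nat_exps" "k_zero P y0 < k"
    and "poly P (z_trunc y0 (S k)) \<noteq> 0"
  shows "strongly_reduced_henselian (Q_poly P y0 k)"
proof -
  let ?w = "omega_zero P y0"
  have w: "?w \<noteq> 0" using k_zero[OF assms(1)] by simp
  have slice_R: "slice (R_poly P y0 k) n = smult (- 1 / ?w) (slice (B k) (n + idx k))" for n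
    by (simp add: R_poly_def slice_smult_single)
  have *: "slice (Q_poly P y0 k) n = 0" if "n \<le> 0" for n
  proof (cases "n = 0")
    \<comment> \<open>At exponent 0 the slice of \<open>R_poly\<close> is \<open>-y\<close>, which
      the added \<open>y\<close> cancels.\<close>
    case True
    then show ?thesis
      using w by (simp add: Q_poly_def slice_add slice_R slice_B_after_k_zero[OF assms(1-3)] slice_pCons)
  next
    case False
    then have "n < 0" using that by simp
    then have "n + idx k < idx k" by simp
    then have "slice (B k) (n + idx k) = 0" using B_below by (simp add: vanishes_below_def)
    with \<open>n < 0\<close> show ?thesis
      by (simp add: Q_poly_def slice_add slice_R slice_pCons lookup_one)
  qed
  \<comment> \<open>Up to a nonzero monomial, Q(x,0) is P(x, z_{S(k)}), which is nonzero in the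
    second alternative of the theorem.\<close>
  have "poly (B k) 0 = poly P (z_trunc y0 (S k))"
    by (simp only: B_eq poly_pcompose) simp
  moreover have "Poly_Mapping.single (- idx k) (1 / - ?w) \<noteq> 0"
    using w by (metis divide_eq_0_iff lookup_single_eq lookup_zero neg_equal_0_iff_equal zero_neq_one)
  ultimately have Q0: "poly (Q_poly P y0 k) 0 \<noteq> 0"
    using assms(4) by (simp add: Q_poly_def R_poly_def)
  then have "Q_poly P y0 k \<noteq> 0" by auto
  with Q0 * show ?thesis
    by (simp add: strongly_reduced_henselian_def val_y_gtI)
qed

text \<open>The tail solves y0 = z_{S(k)} + x^{S(k)} t, hence is a root of \<open>B k\<close> and of
  \<open>R_poly\<close>; adding \<open>y\<close> makes it a fixed point.\<close>

lemma eval_Q_t_tail: "eval_y (Q_poly P y0 k) (t_tail y0 (S k)) = t_tail y0 (S k)"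
proof -
  let ?t = "t_tail y0 (S k)"
  have "eval_y [:z_trunc y0 (S k), xpow (S k):] ?t = y0"
    by (simp add: eval_y_pCons t_tail_def mult.assoc series_of_xpow_inverse)
  then have "eval_y (B k) ?t = 0"
    by (simp only: B_eq eval_y_pcompose root)
  then show ?thesis
    by (simp add: Q_poly_def R_poly_def eval_y_add eval_y_smult eval_y_pCons)
qed

lemma gcoeff_t_tail: "gcoeff (t_tail y0 m) n = (if 0 < n then gcoeff y0 (n + m) else 0)"
  by (auto simp: t_tail_def gcoeff_mult_xpow lookup_z not_less)

text \<open>Exponents of \<open>y0\<close> beyond \<open>S k\<close> are its iterated successors;
  positivity of \<open>n\<close> excludes \<open>S k\<close> itself, so at least two steps from
  \<open>k\<close> are needed.\<close>

lemma supp_t_tail: "supp (t_tail y0 (S k)) \<subseteq> {(S ^^ m) k - S k | m. m \<ge> 2}"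
proof
  fix n assume "n \<in> supp (t_tail y0 (S k))"
  then have n: "0 < n" "gcoeff y0 (n + S k) \<noteq> 0"
    by (auto simp: supp_def gcoeff_t_tail split: if_splits)
  then have "n + S k \<in> nat_exps" using y0_supp by (auto simp: supp_def)
  then obtain m where m: "n + S k = (S ^^ m) (S k)"
    using succ_exp_iter_reaches[of "n + S k" "S k"] less_imp_le[OF n(1)] by auto
  have "m \<noteq> 0"
  proof
    assume "m = 0"
    with m have "n = 0" by simp
    with n(1) show False by simp
  qed
  moreover have "n = (S ^^ Suc m) k - S k"
    using m by (simp only: funpow_Suc_right o_apply) (metis add_diff_cancel_right')
  ultimately show "n \<in> {(S ^^ m) k - S k | m. m \<ge> 2}"
    by (intro CollectI exI[of _ "Suc m"]) auto
qed

lemma gcoeff_t_tail_iter: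
  assumes "m \<ge> 2"
  shows "gcoeff (t_tail y0 (S k)) ((S ^^ m) k - S k) = gcoeff y0 ((S ^^ m) k)"
proof -
  have "S k < (S ^^ m) k"
    using strict_monoD[OF strict_mono_succ_exp_iter, of 1 m k] assms by simp
  then show ?thesis by (simp add: gcoeff_t_tail)
qed

end

theorem theorem5p5:
  fixes P :: "('r::{finite,linorder}, 'a::field_char_0) laurent poly"
    and y0 :: "('r mexp, 'a) gseries"
    and dx dy :: nat
    and k :: "'r mexp"
  assumes r: "CARD('r) \<ge> 2"
    and P_nonzero: "P \<noteq> 0"
    and P_polynomial: "\<And>j. Poly_Mapping.keys (coeff P j) \<subseteq> nat_exps"
    and deg_x: "\<And>j i. i \<in> Poly_Mapping.keys (coeff P j) \<Longrightarrow> total_deg i \<le> int dx"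
    and deg_y: "degree P \<le> dy"
    and y0_series: "supp y0 \<subseteq> {n \<in> nat_exps. n > 0}"
    and c_last: "gcoeff y0 last_unit \<noteq> 0"
    and root: "eval_y P y0 = 0"
    and simple: "eval_y (pderiv P) y0 \<noteq> 0"
    and k_nat: "k \<in> nat_exps"
    and k_gt: "k > k_zero P y0"
  shows "poly P (z_trunc y0 (succ_exp k)) = 0 \<or>
    (let Q = Q_poly P y0 k; t = t_tail y0 (succ_exp k) in
      strongly_reduced_henselian Q \<and>
      t = eval_y Q t \<and>
      supp t \<subseteq> {(succ_exp ^^ m) k - succ_exp k | m. m \<ge> 2} \<and>
      (\<forall>m\<ge>2. gcoeff t ((succ_exp ^^ m) k - succ_exp k) = gcoeff y0 ((succ_exp ^^ m) k)))"
proof -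
  interpret power_series_root P y0
  proof
    show "vanishes_below P 0"
      unfolding vanishes_below_def
    proof (intro allI impI poly_eqI)
      fix n :: "'r mexp" and j assume "n < 0"
      then have "n \<notin> nat_exps" using nat_exps_nonneg[of n] by auto
      then show "coeff (slice P n) j = coeff 0 j"
        using P_polynomial[of j] by (auto simp: in_keys_iff)
    qed
  qed (fact P_nonzero y0_series root)+
  show ?thesis
    using henselian_equation[OF simple k_nat k_gt] eval_Q_t_tail supp_t_tail gcoeff_t_tail_iter
    by (auto simp: Let_def)
qed

end
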